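(* Let $\mathcal{A}$ be an abelian category. The following hold both with all words in parentheses omitted and with all of them included. (1) Assume that $\mathcal{A}$ is AB3*. Then every (strongly) self-CS-Baer object of $\mathcal{A}$ is (strictly) ESSIP. (2) Assume that $\mathcal{A}$ is AB3. Then every dual (strongly) self-CS-Baer object of $\mathcal{A}$ is (strictly) LSSSP.
   Context: An abelian category is AB3 (AB3* ) if it has arbitrary coproducts (products); it then has arbitrary sums (intersections) of families of subobjects. A subobject $i:K\to M$ is fully invariant if for every $h:M\to M$ one has $hi=i\alpha$ for some $\alpha:K\to K$. A subobject $L$ of $M$ lies above a direct summand $K$ of $M$ if $K\subseteq L$ and $L/K$ is superfluous in $M/K$ (a subobject $A$ of $B$ is superfluous if $A+X=B$ implies $X=B$ for every subobject $X$ of $B$). In an AB3* abelian category: $M$ is (strongly) self-CS-Baer if for every family $(f_i)_{i\in I}$ of endomorphisms of $M$, $\bigcap_{i\in I}\mathrm{Ker}(f_i)$ is essential in a (fully invariant) direct summand of $M$; $M$ is (strictly) ESSIP if for any family of direct summands of $M$, their intersection is essential in a (fully invariant) direct summand of $M$. In an AB3 abelian category: $M$ is dual (strongly) self-CS-Baer if for every family $(f_i)_{i\in I}$ of endomorphisms of $M$, $\sum_{i\in I}\mathrm{Im}(f_i)$ lies above a (fully invariant) direct summand of $M$; $M$ is (strictly) LSSSP if for any family of direct summands of $M$, their sum lies above a (fully invariant) direct summand of $M$. *)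

theory Defs
  imports "HOL-Algebra.Group"
begin

section \<open>Abelian categories\<close>

text \<open>
  Objects and arrows are the elements of the carriers \<open>Obj\<close> and \<open>Arr\<close>; the operations are
  only constrained on these carriers.  The composite \<open>g \<cdot> f\<close> is meaningful when
  \<open>Dom g = Cod f\<close>, the sum \<open>f \<uplus> g\<close> when \<open>f\<close> and \<open>g\<close> are parallel, and \<open>Zero A B\<close> is the zero
  arrow from \<open>A\<close> to \<open>B\<close>.
\<close>

record ('o, 'a) precategory =
  Obj :: "'o set"
  Arr :: "'a set"
  Dom :: "'a \<Rightarrow> 'o"
  Cod :: "'a \<Rightarrow> 'o"
  Id :: "'o \<Rightarrow> 'a"
  Comp :: "'a \<Rightarrow> 'a \<Rightarrow> 'a" (infixr "\<cdot>\<index>" 75)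
  Add :: "'a \<Rightarrow> 'a \<Rightarrow> 'a" (infixl "\<uplus>\<index>" 65)
  Zero :: "'o \<Rightarrow> 'o \<Rightarrow> 'a"

definition Hom :: "('o, 'a, 'm) precategory_scheme \<Rightarrow> 'o \<Rightarrow> 'o \<Rightarrow> 'a set" where
  "Hom C A B = {f \<in> Arr C. Dom C f = A \<and> Cod C f = B}"

locale category =
  fixes C :: "('o, 'a, 'm) precategory_scheme" (structure)
  assumes dom_closed: "f \<in> Arr C \<Longrightarrow> Dom C f \<in> Obj C"
    and cod_closed: "f \<in> Arr C \<Longrightarrow> Cod C f \<in> Obj C"
    and id_closed: "A \<in> Obj C \<Longrightarrow> Id C A \<in> Hom C A A"
    and comp_closed: "\<lbrakk>f \<in> Hom C A B; g \<in> Hom C B D\<rbrakk> \<Longrightarrow> g \<cdot> f \<in> Hom C A D"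
    and comp_id: "f \<in> Hom C A B \<Longrightarrow> f \<cdot> Id C A = f"
    and id_comp: "f \<in> Hom C A B \<Longrightarrow> Id C B \<cdot> f = f"
    and comp_assoc: "\<lbrakk>f \<in> Hom C A B; g \<in> Hom C B D; h \<in> Hom C D E\<rbrakk>
           \<Longrightarrow> (h \<cdot> g) \<cdot> f = h \<cdot> (g \<cdot> f)"

locale preadditive_category = category +
  assumes hom_group: "\<lbrakk>A \<in> Obj C; B \<in> Obj C\<rbrakk>
           \<Longrightarrow> comm_group \<lparr>carrier = Hom C A B, monoid.mult = Add C, one = Zero C A B\<rparr>"
    and comp_add: "\<lbrakk>f \<in> Hom C A B; g \<in> Hom C A B; h \<in> Hom C B D\<rbrakk>
           \<Longrightarrow> h \<cdot> (f \<uplus> g) = (h \<cdot> f) \<uplus> (h \<cdot> g)"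
    and add_comp: "\<lbrakk>f \<in> Hom C A B; g \<in> Hom C B D; h \<in> Hom C B D\<rbrakk>
           \<Longrightarrow> (g \<uplus> h) \<cdot> f = (g \<cdot> f) \<uplus> (h \<cdot> f)"

definition is_mono :: "('o, 'a, 'm) precategory_scheme \<Rightarrow> 'a \<Rightarrow> bool" where
  "is_mono C f \<longleftrightarrow> f \<in> Arr C \<and>
     (\<forall>X\<in>Obj C. \<forall>g\<in>Hom C X (Dom C f). \<forall>h\<in>Hom C X (Dom C f).
        f \<cdot>\<^bsub>C\<^esub> g = f \<cdot>\<^bsub>C\<^esub> h \<longrightarrow> g = h)"

definition is_epi :: "('o, 'a, 'm) precategory_scheme \<Rightarrow> 'a \<Rightarrow> bool" where
  "is_epi C f \<longleftrightarrow> f \<in> Arr C \<and>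
     (\<forall>X\<in>Obj C. \<forall>g\<in>Hom C (Cod C f) X. \<forall>h\<in>Hom C (Cod C f) X.
        g \<cdot>\<^bsub>C\<^esub> f = h \<cdot>\<^bsub>C\<^esub> f \<longrightarrow> g = h)"

definition is_iso :: "('o, 'a, 'm) precategory_scheme \<Rightarrow> 'a \<Rightarrow> bool" where
  "is_iso C f \<longleftrightarrow> f \<in> Arr C \<and>
     (\<exists>g\<in>Hom C (Cod C f) (Dom C f).
        g \<cdot>\<^bsub>C\<^esub> f = Id C (Dom C f) \<and> f \<cdot>\<^bsub>C\<^esub> g = Id C (Cod C f))"

definition is_zero_object :: "('o, 'a, 'm) precategory_scheme \<Rightarrow> 'o \<Rightarrow> bool" where
  "is_zero_object C Z \<longleftrightarrow> Z \<in> Obj C \<and>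
     (\<forall>X\<in>Obj C. (\<exists>!f. f \<in> Hom C X Z) \<and> (\<exists>!f. f \<in> Hom C Z X))"

definition is_kernel :: "('o, 'a, 'm) precategory_scheme \<Rightarrow> 'a \<Rightarrow> 'a \<Rightarrow> bool" where
  "is_kernel C f k \<longleftrightarrow> f \<in> Arr C \<and> k \<in> Arr C \<and> Cod C k = Dom C f \<and>
     f \<cdot>\<^bsub>C\<^esub> k = Zero C (Dom C k) (Cod C f) \<and>
     (\<forall>X\<in>Obj C. \<forall>x\<in>Hom C X (Dom C f). f \<cdot>\<^bsub>C\<^esub> x = Zero C X (Cod C f) \<longrightarrow>
        (\<exists>!u. u \<in> Hom C X (Dom C k) \<and> k \<cdot>\<^bsub>C\<^esub> u = x))"

definition is_cokernel :: "('o, 'a, 'm) precategory_scheme \<Rightarrow> 'a \<Rightarrow> 'a \<Rightarrow> bool" where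
  "is_cokernel C f q \<longleftrightarrow> f \<in> Arr C \<and> q \<in> Arr C \<and> Dom C q = Cod C f \<and>
     q \<cdot>\<^bsub>C\<^esub> f = Zero C (Dom C f) (Cod C q) \<and>
     (\<forall>X\<in>Obj C. \<forall>x\<in>Hom C (Cod C f) X. x \<cdot>\<^bsub>C\<^esub> f = Zero C (Dom C f) X \<longrightarrow>
        (\<exists>!u. u \<in> Hom C (Cod C q) X \<and> u \<cdot>\<^bsub>C\<^esub> q = x))"

text \<open>In an abelian category the image of \<open>f\<close> is the kernel of its cokernel.\<close>

definition is_image :: "('o, 'a, 'm) precategory_scheme \<Rightarrow> 'a \<Rightarrow> 'a \<Rightarrow> bool" where
  "is_image C f m \<longleftrightarrow> (\<exists>q. is_cokernel C f q \<and> is_kernel C q m)"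

definition is_biproduct ::
  "('o, 'a, 'm) precategory_scheme \<Rightarrow> 'o \<Rightarrow> 'o \<Rightarrow> 'o \<Rightarrow> 'a \<Rightarrow> 'a \<Rightarrow> 'a \<Rightarrow> 'a \<Rightarrow> bool" where
  "is_biproduct C A B S i j p q \<longleftrightarrow>
     i \<in> Hom C A S \<and> j \<in> Hom C B S \<and> p \<in> Hom C S A \<and> q \<in> Hom C S B \<and>
     p \<cdot>\<^bsub>C\<^esub> i = Id C A \<and> q \<cdot>\<^bsub>C\<^esub> j = Id C B \<and>
     q \<cdot>\<^bsub>C\<^esub> i = Zero C A B \<and> p \<cdot>\<^bsub>C\<^esub> j = Zero C B A \<and>
     (i \<cdot>\<^bsub>C\<^esub> p) \<uplus>\<^bsub>C\<^esub> (j \<cdot>\<^bsub>C\<^esub> q) = Id C S"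

locale abelian_category = preadditive_category +
  assumes zero_object_exists: "\<exists>Z. is_zero_object C Z"
    and biproduct_exists: "\<lbrakk>A \<in> Obj C; B \<in> Obj C\<rbrakk>
           \<Longrightarrow> \<exists>S\<in>Obj C. \<exists>i j p q. is_biproduct C A B S i j p q"
    and kernel_exists: "f \<in> Arr C \<Longrightarrow> \<exists>k. is_kernel C f k"
    and cokernel_exists: "f \<in> Arr C \<Longrightarrow> \<exists>q. is_cokernel C f q"
    and mono_normal: "is_mono C f \<Longrightarrow> \<exists>g. is_kernel C g f"
    and epi_normal: "is_epi C f \<Longrightarrow> \<exists>g. is_cokernel C g f"


section \<open>Arbitrary products and coproducts\<close>

text \<open>
  There is no type of all index sets, and a category whose products are indexed by its own
  arrows is a preorder, so ``arbitrary'' families need a notion of smallness.  The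
  parameter \<open>U\<close> is the collection of index sets that count as small (for instance the members of a
  Grothendieck universe); families indexed by some \<open>I \<in> U\<close> are the arbitrary families.
  The same \<open>U\<close> is used for (co)products, families of endomorphisms and families of direct
  summands.
\<close>

definition is_product ::
  "('o, 'a, 'm) precategory_scheme \<Rightarrow> 'i set \<Rightarrow> ('i \<Rightarrow> 'o) \<Rightarrow> 'o \<Rightarrow> ('i \<Rightarrow> 'a) \<Rightarrow> bool" where
  "is_product C I A P p \<longleftrightarrow> P \<in> Obj C \<and> (\<forall>i\<in>I. p i \<in> Hom C P (A i)) \<and>
     (\<forall>X\<in>Obj C. \<forall>f. (\<forall>i\<in>I. f i \<in> Hom C X (A i)) \<longrightarrow>
        (\<exists>!u. u \<in> Hom C X P \<and> (\<forall>i\<in>I. p i \<cdot>\<^bsub>C\<^esub> u = f i)))"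

definition is_coproduct ::
  "('o, 'a, 'm) precategory_scheme \<Rightarrow> 'i set \<Rightarrow> ('i \<Rightarrow> 'o) \<Rightarrow> 'o \<Rightarrow> ('i \<Rightarrow> 'a) \<Rightarrow> bool" where
  "is_coproduct C I A P j \<longleftrightarrow> P \<in> Obj C \<and> (\<forall>i\<in>I. j i \<in> Hom C (A i) P) \<and>
     (\<forall>X\<in>Obj C. \<forall>f. (\<forall>i\<in>I. f i \<in> Hom C (A i) X) \<longrightarrow>
        (\<exists>!u. u \<in> Hom C P X \<and> (\<forall>i\<in>I. u \<cdot>\<^bsub>C\<^esub> j i = f i)))"

definition AB3 :: "'i set set \<Rightarrow> ('o, 'a, 'm) precategory_scheme \<Rightarrow> bool" where
  "AB3 U C \<longleftrightarrow> (\<forall>I\<in>U. \<forall>A\<in>I \<rightarrow> Obj C. \<exists>P j. is_coproduct C I A P j)"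

definition AB3star :: "'i set set \<Rightarrow> ('o, 'a, 'm) precategory_scheme \<Rightarrow> bool" where
  "AB3star U C \<longleftrightarrow> (\<forall>I\<in>U. \<forall>A\<in>I \<rightarrow> Obj C. \<exists>P p. is_product C I A P p)"


section \<open>Subobjects\<close>

text \<open>
  A subobject of \<open>M\<close> is represented by a monomorphism into \<open>M\<close>; two representatives give the same
  subobject iff they are \<open>sub_le\<close> each other.
\<close>

definition is_sub :: "('o, 'a, 'm) precategory_scheme \<Rightarrow> 'o \<Rightarrow> 'a \<Rightarrow> bool" where
  "is_sub C M k \<longleftrightarrow> is_mono C k \<and> Cod C k = M"

definition sub_le :: "('o, 'a, 'm) precategory_scheme \<Rightarrow> 'a \<Rightarrow> 'a \<Rightarrow> bool" where
  "sub_le C k l \<longleftrightarrow> (\<exists>u\<in>Hom C (Dom C k) (Dom C l). l \<cdot>\<^bsub>C\<^esub> u = k)"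

text \<open>
  The intersection and the sum of a set \<open>S\<close> of subobjects of \<open>M\<close> are its infimum and supremum among
  the subobjects of \<open>M\<close> (\<open>M\<close> itself and the zero subobject for empty \<open>S\<close>).
\<close>

definition is_intersection ::
  "('o, 'a, 'm) precategory_scheme \<Rightarrow> 'o \<Rightarrow> 'a set \<Rightarrow> 'a \<Rightarrow> bool" where
  "is_intersection C M S m \<longleftrightarrow> is_sub C M m \<and> (\<forall>k\<in>S. sub_le C m k) \<and>
     (\<forall>t. is_sub C M t \<and> (\<forall>k\<in>S. sub_le C t k) \<longrightarrow> sub_le C t m)"

definition is_sum ::
  "('o, 'a, 'm) precategory_scheme \<Rightarrow> 'o \<Rightarrow> 'a set \<Rightarrow> 'a \<Rightarrow> bool" where
  "is_sum C M S s \<longleftrightarrow> is_sub C M s \<and> (\<forall>k\<in>S. sub_le C k s) \<and>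
     (\<forall>t. is_sub C M t \<and> (\<forall>k\<in>S. sub_le C k t) \<longrightarrow> sub_le C s t)"

definition fully_invariant :: "('o, 'a, 'm) precategory_scheme \<Rightarrow> 'o \<Rightarrow> 'a \<Rightarrow> bool" where
  "fully_invariant C M i \<longleftrightarrow> is_sub C M i \<and>
     (\<forall>h\<in>Hom C M M. \<exists>\<alpha>\<in>Hom C (Dom C i) (Dom C i). h \<cdot>\<^bsub>C\<^esub> i = i \<cdot>\<^bsub>C\<^esub> \<alpha>)"

definition direct_summand :: "('o, 'a, 'm) precategory_scheme \<Rightarrow> 'o \<Rightarrow> 'a \<Rightarrow> bool" where
  "direct_summand C M k \<longleftrightarrow> is_sub C M k \<and>
     (\<exists>B\<in>Obj C. \<exists>j p q. is_biproduct C (Dom C k) B M k j p q)"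

text \<open>Essential: \<open>A \<inter> X = 0\<close> implies \<open>X = 0\<close>.  Superfluous: \<open>A + X = B\<close> implies \<open>X = B\<close>.\<close>

definition essential :: "('o, 'a, 'm) precategory_scheme \<Rightarrow> 'o \<Rightarrow> 'a \<Rightarrow> bool" where
  "essential C B a \<longleftrightarrow> is_sub C B a \<and>
     (\<forall>x z. is_sub C B x \<and> is_intersection C B {a, x} z \<and> is_zero_object C (Dom C z) \<longrightarrow>
        is_zero_object C (Dom C x))"

definition superfluous :: "('o, 'a, 'm) precategory_scheme \<Rightarrow> 'o \<Rightarrow> 'a \<Rightarrow> bool" where
  "superfluous C B a \<longleftrightarrow> is_sub C B a \<and>
     (\<forall>x. is_sub C B x \<and> is_sum C B {a, x} (Id C B) \<longrightarrow> is_iso C x)"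

text \<open>For subobjects \<open>m\<close>, \<open>d\<close> of the same object: \<open>m \<subseteq> d\<close> and \<open>m\<close> is essential in \<open>d\<close>.\<close>

definition essential_in :: "('o, 'a, 'm) precategory_scheme \<Rightarrow> 'a \<Rightarrow> 'a \<Rightarrow> bool" where
  "essential_in C m d \<longleftrightarrow>
     (\<exists>\<alpha>\<in>Hom C (Dom C m) (Dom C d). d \<cdot>\<^bsub>C\<^esub> \<alpha> = m \<and> essential C (Dom C d) \<alpha>)"

text \<open>
  For subobjects \<open>l : L \<rightarrow> M\<close> and \<open>k : K \<rightarrow> M\<close> with \<open>K \<subseteq> L\<close> via \<open>\<alpha>\<close>: \<open>qM : M \<rightarrow> M/K\<close> and
  \<open>qL : L \<rightarrow> L/K\<close> are cokernels of \<open>k\<close> and \<open>\<alpha>\<close>, and \<open>t : L/K \<rightarrow> M/K\<close> is the induced inclusion.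
\<close>

definition lies_above :: "('o, 'a, 'm) precategory_scheme \<Rightarrow> 'a \<Rightarrow> 'a \<Rightarrow> bool" where
  "lies_above C l k \<longleftrightarrow>
     (\<exists>\<alpha>\<in>Hom C (Dom C k) (Dom C l). l \<cdot>\<^bsub>C\<^esub> \<alpha> = k \<and>
        (\<exists>qM qL. is_cokernel C k qM \<and> is_cokernel C \<alpha> qL \<and>
           (\<exists>t\<in>Hom C (Cod C qL) (Cod C qM).
              t \<cdot>\<^bsub>C\<^esub> qL = qM \<cdot>\<^bsub>C\<^esub> l \<and> superfluous C (Cod C qM) t)))"


section \<open>Self-CS-Baer, ESSIP and their duals\<close>

definition self_CS_Baer ::
  "'i set set \<Rightarrow> ('o, 'a, 'm) precategory_scheme \<Rightarrow> 'o \<Rightarrow> bool" where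
  "self_CS_Baer U C M \<longleftrightarrow>
     (\<forall>I\<in>U. \<forall>f\<in>I \<rightarrow> Hom C M M.
        \<exists>k m d. (\<forall>i\<in>I. is_kernel C (f i) (k i)) \<and> is_intersection C M (k ` I) m \<and>
          direct_summand C M d \<and> essential_in C m d)"

definition strongly_self_CS_Baer ::
  "'i set set \<Rightarrow> ('o, 'a, 'm) precategory_scheme \<Rightarrow> 'o \<Rightarrow> bool" where
  "strongly_self_CS_Baer U C M \<longleftrightarrow>
     (\<forall>I\<in>U. \<forall>f\<in>I \<rightarrow> Hom C M M.
        \<exists>k m d. (\<forall>i\<in>I. is_kernel C (f i) (k i)) \<and> is_intersection C M (k ` I) m \<and>
          direct_summand C M d \<and> fully_invariant C M d \<and> essential_in C m d)"

definition ESSIP :: "'i set set \<Rightarrow> ('o, 'a, 'm) precategory_scheme \<Rightarrow> 'o \<Rightarrow> bool" where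
  "ESSIP U C M \<longleftrightarrow>
     (\<forall>I\<in>U. \<forall>k\<in>I \<rightarrow> Collect (direct_summand C M).
        \<exists>m d. is_intersection C M (k ` I) m \<and>
          direct_summand C M d \<and> essential_in C m d)"

definition strictly_ESSIP :: "'i set set \<Rightarrow> ('o, 'a, 'm) precategory_scheme \<Rightarrow> 'o \<Rightarrow> bool" where
  "strictly_ESSIP U C M \<longleftrightarrow>
     (\<forall>I\<in>U. \<forall>k\<in>I \<rightarrow> Collect (direct_summand C M).
        \<exists>m d. is_intersection C M (k ` I) m \<and>
          direct_summand C M d \<and> fully_invariant C M d \<and> essential_in C m d)"

definition dual_self_CS_Baer ::
  "'i set set \<Rightarrow> ('o, 'a, 'm) precategory_scheme \<Rightarrow> 'o \<Rightarrow> bool" where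
  "dual_self_CS_Baer U C M \<longleftrightarrow>
     (\<forall>I\<in>U. \<forall>f\<in>I \<rightarrow> Hom C M M.
        \<exists>k s d. (\<forall>i\<in>I. is_image C (f i) (k i)) \<and> is_sum C M (k ` I) s \<and>
          direct_summand C M d \<and> lies_above C s d)"

definition dual_strongly_self_CS_Baer ::
  "'i set set \<Rightarrow> ('o, 'a, 'm) precategory_scheme \<Rightarrow> 'o \<Rightarrow> bool" where
  "dual_strongly_self_CS_Baer U C M \<longleftrightarrow>
     (\<forall>I\<in>U. \<forall>f\<in>I \<rightarrow> Hom C M M.
        \<exists>k s d. (\<forall>i\<in>I. is_image C (f i) (k i)) \<and> is_sum C M (k ` I) s \<and>
          direct_summand C M d \<and> fully_invariant C M d \<and> lies_above C s d)"

definition LSSSP :: "'i set set \<Rightarrow> ('o, 'a, 'm) precategory_scheme \<Rightarrow> 'o \<Rightarrow> bool" where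
  "LSSSP U C M \<longleftrightarrow>
     (\<forall>I\<in>U. \<forall>k\<in>I \<rightarrow> Collect (direct_summand C M).
        \<exists>s d. is_sum C M (k ` I) s \<and>
          direct_summand C M d \<and> lies_above C s d)"

definition strictly_LSSSP :: "'i set set \<Rightarrow> ('o, 'a, 'm) precategory_scheme \<Rightarrow> 'o \<Rightarrow> bool" where
  "strictly_LSSSP U C M \<longleftrightarrow>
     (\<forall>I\<in>U. \<forall>k\<in>I \<rightarrow> Collect (direct_summand C M).
        \<exists>s d. is_sum C M (k ` I) s \<and>
          direct_summand C M d \<and> fully_invariant C M d \<and> lies_above C s d)"

end

theory Submission
  imports Defs
begin

text \<open>
  If \<open>k\<close> is a direct summand of \<open>M\<close> with biproduct data \<open>k, j, p, q\<close>, then \<open>k\<close> is equivalent, as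
  a subobject, to every kernel of the endomorphism \<open>j \<cdot> q\<close> and to every image of the
  endomorphism \<open>k \<cdot> p\<close>. Intersections and sums only depend on subobjects up to equivalence, so the
  Baer conditions, applied to these endomorphisms, cover all families of direct summands.
\<close>

lemma HomI: "f \<in> Arr C \<Longrightarrow> f \<in> Hom C (Dom C f) (Cod C f)"
  by (simp add: Hom_def)

lemma HomD:
  assumes "f \<in> Hom C A B"
  shows "f \<in> Arr C" "Dom C f = A" "Cod C f = B"
  using assms by (simp_all add: Hom_def)

section \<open>Subobjects up to equivalence, and their intersections and sums\<close>

context category
begin

lemma Hom_obj:
  assumes "f \<in> Hom C A B"
  shows "A \<in> Obj C" "B \<in> Obj C"
  using assms dom_closed cod_closed by (auto simp: Hom_def)

lemma sub_le_trans:
  assumes "m \<in> Arr C" "sub_le C k l" "sub_le C l m"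
  shows "sub_le C k m"
proof -
  obtain u v where u: "u \<in> Hom C (Dom C k) (Dom C l)" "l \<cdot> u = k"
    and v: "v \<in> Hom C (Dom C l) (Dom C m)" "m \<cdot> v = l"
    using assms(2,3) by (auto simp: sub_le_def)
  have "m \<cdot> (v \<cdot> u) = k"
    using comp_assoc[OF u(1) v(1) HomI[OF assms(1)]] u(2) v(2) by simp
  then show ?thesis
    using comp_closed[OF u(1) v(1)] by (auto simp: sub_le_def)
qed

text \<open>By transitivity both families have the same lower bounds, and an intersection is
  determined by lower bounds alone. Transitivity needs an arrow at the upper end, which here is a
  member of the family; hence the two inclusions in \<open>Arr C\<close>.\<close>

lemma is_intersection_cong:
  assumes "k ` I \<subseteq> Arr C" "l ` I \<subseteq> Arr C"
    and "\<And>i. i \<in> I \<Longrightarrow> sub_le C (k i) (l i) \<and> sub_le C (l i) (k i)"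
  shows "is_intersection C M (k ` I) m \<longleftrightarrow> is_intersection C M (l ` I) m"
proof -
  have "(\<forall>x\<in>k ` I. sub_le C t x) \<longleftrightarrow> (\<forall>x\<in>l ` I. sub_le C t x)" for t
  proof -
    have "sub_le C t (k i) \<longleftrightarrow> sub_le C t (l i)" if "i \<in> I" for i
    proof -
      have "k i \<in> Arr C" "l i \<in> Arr C"
        using assms(1,2) that by auto
      then show ?thesis
        using assms(3)[OF that] sub_le_trans[of "k i" t "l i"] sub_le_trans[of "l i" t "k i"]
        by blast
    qed
    then show ?thesis by simp
  qed
  then show ?thesis
    by (simp only: is_intersection_def)
qed

text \<open>Both families have the same upper bounds. The upper end is now the bounding subobject,
  which is an arrow because it is a monomorphism.\<close>

lemma is_sum_cong:
  assumes "\<And>i. i \<in> I \<Longrightarrow> sub_le C (k i) (l i) \<and> sub_le C (l i) (k i)"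
  shows "is_sum C M (k ` I) s \<longleftrightarrow> is_sum C M (l ` I) s"
proof -
  have "(\<forall>x\<in>k ` I. sub_le C x t) \<longleftrightarrow> (\<forall>x\<in>l ` I. sub_le C x t)" if "is_sub C M t" for t
  proof -
    have "t \<in> Arr C"
      using that by (simp add: is_sub_def is_mono_def)
    then have "sub_le C (k i) t \<longleftrightarrow> sub_le C (l i) t" if "i \<in> I" for i
      using assms[OF that] sub_le_trans[of t "k i" "l i"] sub_le_trans[of t "l i" "k i"]
      by blast
    then show ?thesis by simp
  qed
  then show ?thesis
    \<comment> \<open>The congruence rule makes the conjunct \<open>is_sub\<close> available while
      the bound next to it is rewritten.\<close>
    by (simp only: is_sum_def cong: conj_cong)
qed

end

section \<open>Zero arrows and composition\<close>

context preadditive_category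
begin

lemma zero_closed: "\<lbrakk>A \<in> Obj C; B \<in> Obj C\<rbrakk> \<Longrightarrow> Zero C A B \<in> Hom C A B"
  using comm_group.axioms(2)[OF hom_group, THEN group.is_monoid, THEN monoid.one_closed] by simp

lemma add_zero: "f \<in> Hom C A B \<Longrightarrow> f \<uplus> Zero C A B = f"
  using comm_group.axioms(2)[OF hom_group, THEN group.is_monoid, THEN monoid.r_one]
    Hom_obj by fastforce

text \<open>Cancellation in the hom group. Distributivity makes a composite with a zero arrow equal
  to its own double, so this yields the two absorption laws below.\<close>

lemma double_eq_zero:
  assumes "f \<in> Hom C A B" "f \<uplus> f = f"
  shows "f = Zero C A B"
proof -
  interpret G: comm_group "\<lparr>carrier = Hom C A B, monoid.mult = Add C, one = Zero C A B\<rparr>"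
    using hom_group Hom_obj assms(1) by blast
  show ?thesis
    using G.r_cancel_one[of f f] assms by simp
qed

lemma comp_zero:
  assumes "X \<in> Obj C" "h \<in> Hom C A B"
  shows "h \<cdot> Zero C X A = Zero C X B"
proof (rule double_eq_zero)
  have z: "Zero C X A \<in> Hom C X A"
    using assms zero_closed Hom_obj by blast
  then show "h \<cdot> Zero C X A \<in> Hom C X B"
    using assms comp_closed by blast
  show "h \<cdot> Zero C X A \<uplus> h \<cdot> Zero C X A = h \<cdot> Zero C X A"
    using comp_add[OF z z assms(2)] add_zero[OF z] by simp
qed

lemma zero_comp:
  assumes "X \<in> Obj C" "f \<in> Hom C A B"
  shows "Zero C B X \<cdot> f = Zero C A X"
proof (rule double_eq_zero)
  have z: "Zero C B X \<in> Hom C B X"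
    using assms zero_closed Hom_obj by blast
  then show "Zero C B X \<cdot> f \<in> Hom C A X"
    using assms comp_closed by blast
  show "Zero C B X \<cdot> f \<uplus> Zero C B X \<cdot> f = Zero C B X \<cdot> f"
    using add_comp[OF assms(2) z z] add_zero[OF z] by simp
qed

section \<open>Kernels and images of the projections of a biproduct\<close>

context
  fixes A B S i j p q
  assumes biproduct: "is_biproduct C A B S i j p q"
begin

lemma biproduct_hom:
  "i \<in> Hom C A S" "j \<in> Hom C B S" "p \<in> Hom C S A" "q \<in> Hom C S B"
  using biproduct by (auto simp: is_biproduct_def)

lemma biproduct_eqs:
  "p \<cdot> i = Id C A" "q \<cdot> j = Id C B" "q \<cdot> i = Zero C A B" "i \<cdot> p \<uplus> j \<cdot> q = Id C S"
  using biproduct by (auto simp: is_biproduct_def)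

text \<open>Half of the fact that \<open>i\<close> is a kernel of \<open>q\<close>: expanding the
  identity as \<open>i \<cdot> p \<uplus> j \<cdot> q\<close> leaves
  \<open>x = i \<cdot> (p \<cdot> x)\<close>.\<close>

lemma biproduct_sub_le:
  assumes "x \<in> Hom C X S" "q \<cdot> x = Zero C X B"
  shows "sub_le C x i"
proof -
  note h = biproduct_hom
  have "x = (i \<cdot> p \<uplus> j \<cdot> q) \<cdot> x"
    using id_comp[OF assms(1)] biproduct_eqs by simp
  also have "\<dots> = i \<cdot> (p \<cdot> x) \<uplus> j \<cdot> (q \<cdot> x)"
    using add_comp[OF assms(1) comp_closed[OF h(3,1)] comp_closed[OF h(4,2)]]
      comp_assoc[OF assms(1) h(3,1)] comp_assoc[OF assms(1) h(4,2)] by simp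
  also have "\<dots> = i \<cdot> (p \<cdot> x)"
    using assms(2) comp_zero[OF Hom_obj(1)[OF assms(1)] h(2)]
      add_zero[OF comp_closed[OF comp_closed[OF assms(1) h(3)] h(1)]] by simp
  finally show ?thesis
    using comp_closed[OF assms(1) h(3)] assms(1) h(1)
    by (auto simp: sub_le_def Hom_def)
qed

text \<open>Since \<open>q\<close> splits \<open>j\<close>, the arrows \<open>j \<cdot> q\<close>
  and \<open>q\<close> annihilate the same arrows into \<open>S\<close>, namely those that factor
  through \<open>i\<close>.\<close>

lemma biproduct_kernel:
  assumes "is_kernel C (j \<cdot> q) k"
  shows "sub_le C k i \<and> sub_le C i k"
proof
  note h = biproduct_hom
  note jq = comp_closed[OF h(4,2)]
  have k: "k \<in> Hom C (Dom C k) S" and jqk: "(j \<cdot> q) \<cdot> k = Zero C (Dom C k) S"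
    using assms HomD[OF jq] by (auto simp: is_kernel_def Hom_def)
  note qk = comp_closed[OF k h(4)]
  \<comment> \<open>Inserting \<open>q \<cdot> j = Id C B\<close> brings the vanishing composite
    \<open>(j \<cdot> q) \<cdot> k\<close> into play.\<close>
  have "q \<cdot> k = q \<cdot> (j \<cdot> (q \<cdot> k))"
    using id_comp[OF qk] comp_assoc[OF qk h(2,4)] biproduct_eqs by simp
  also have "\<dots> = Zero C (Dom C k) B"
    using comp_assoc[OF k h(4,2)] jqk comp_zero[OF Hom_obj(1)[OF k] h(4)] by simp
  finally show "sub_le C k i"
    using biproduct_sub_le[OF k] by blast
  have "(j \<cdot> q) \<cdot> i = Zero C A S"
    using comp_assoc[OF h(1,4,2)] biproduct_eqs comp_zero[OF Hom_obj(1)[OF h(1)] h(2)] by simp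
  then have "\<exists>u. u \<in> Hom C A (Dom C k) \<and> k \<cdot> u = i"
    using assms h(1) HomD[OF jq] Hom_obj(1)[OF h(1)] unfolding is_kernel_def by metis
  then show "sub_le C i k"
    using HomD(2)[OF h(1)] by (auto simp: sub_le_def)
qed

text \<open>An arrow out of \<open>S\<close> annihilates \<open>i \<cdot> p\<close> iff it
  annihilates \<open>i\<close>, because \<open>p \<cdot> i\<close> is the identity. So the cokernel
  \<open>c\<close> annihilates \<open>i\<close>, while \<open>q\<close> factors through
  \<open>c\<close>.\<close>

lemma biproduct_image:
  assumes "is_image C (i \<cdot> p) k"
  shows "sub_le C k i \<and> sub_le C i k"
proof
  note h = biproduct_hom
  note ip = comp_closed[OF h(3,1)]
  obtain c where coker: "is_cokernel C (i \<cdot> p) c" and ker: "is_kernel C c k"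
    using assms by (auto simp: is_image_def)
  have c: "c \<in> Hom C S (Cod C c)" and cip: "c \<cdot> (i \<cdot> p) = Zero C S (Cod C c)"
    using coker HomD[OF ip] by (auto simp: is_cokernel_def Hom_def)
  have k: "k \<in> Hom C (Dom C k) S" and ck: "c \<cdot> k = Zero C (Dom C k) (Cod C c)"
    using ker HomD[OF c] by (auto simp: is_kernel_def Hom_def)
  have "q \<cdot> (i \<cdot> p) = Zero C S B"
    using comp_assoc[OF h(3,1,4)] biproduct_eqs zero_comp[OF Hom_obj(2)[OF h(4)] h(3)] by simp
  then obtain u where u: "u \<in> Hom C (Cod C c) B" "u \<cdot> c = q"
    using coker h(4) HomD[OF ip] Hom_obj(2)[OF h(4)] unfolding is_cokernel_def by metis
  have "q \<cdot> k = Zero C (Dom C k) B"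
    using comp_assoc[OF k c u(1)] u(2) ck comp_zero[OF Hom_obj(1)[OF k] u(1)] by simp
  then show "sub_le C k i"
    using biproduct_sub_le[OF k] by blast
  have "c \<cdot> i = (c \<cdot> (i \<cdot> p)) \<cdot> i"
    using comp_assoc[OF h(1) ip c] comp_assoc[OF h(1,3,1)] biproduct_eqs comp_id[OF h(1)] by simp
  also have "\<dots> = Zero C A (Cod C c)"
    using cip zero_comp[OF Hom_obj(2)[OF c] h(1)] by simp
  finally have "\<exists>u. u \<in> Hom C A (Dom C k) \<and> k \<cdot> u = i"
    using ker h(1) HomD[OF c] Hom_obj(1)[OF h(1)] unfolding is_kernel_def by metis
  then show "sub_le C i k"
    using HomD(2)[OF h(1)] by (auto simp: sub_le_def)
qed

end

section \<open>Families of direct summands as families of kernels and images\<close>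

lemma direct_summand_kernel:
  assumes "direct_summand C M k"
  shows "\<exists>f\<in>Hom C M M. \<forall>l. is_kernel C f l \<longrightarrow> sub_le C l k \<and> sub_le C k l"
proof -
  obtain B j p q where b: "is_biproduct C (Dom C k) B M k j p q"
    using assms by (auto simp: direct_summand_def)
  note h = biproduct_hom[OF b]
  \<comment> \<open>The witness is the projection \<open>j \<cdot> q\<close> onto the
    complement.\<close>
  show ?thesis
    using biproduct_kernel[OF b] comp_closed[OF h(4,2)] by blast
qed

lemma direct_summand_image:
  assumes "direct_summand C M k"
  shows "\<exists>f\<in>Hom C M M. \<forall>l. is_image C f l \<longrightarrow> sub_le C l k \<and> sub_le C k l"
proof -
  obtain B j p q where b: "is_biproduct C (Dom C k) B M k j p q"
    using assms by (auto simp: direct_summand_def)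
  note h = biproduct_hom[OF b]
  \<comment> \<open>The witness is the projection \<open>k \<cdot> p\<close> onto the summand
    itself.\<close>
  show ?thesis
    using biproduct_image[OF b] comp_closed[OF h(3,1)] by blast
qed

text \<open>The abstract \<open>P\<close> serves the plain and the strong notion at once. The same
  \<open>m\<close> is an intersection of the kernels and of the summands, so \<open>P m d\<close>
  carries over unchanged.\<close>

lemma direct_summands_intersection:
  assumes "\<forall>f\<in>I \<rightarrow> Hom C M M. \<exists>k m d.
      (\<forall>i\<in>I. is_kernel C (f i) (k i)) \<and> is_intersection C M (k ` I) m \<and> P m d"
    and k: "k \<in> I \<rightarrow> Collect (direct_summand C M)"
  shows "\<exists>m d. is_intersection C M (k ` I) m \<and> P m d"
proof -
  have "\<forall>i\<in>I. \<exists>f. f \<in> Hom C M M \<and>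
      (\<forall>l. is_kernel C f l \<longrightarrow> sub_le C l (k i) \<and> sub_le C (k i) l)"
    using direct_summand_kernel k by blast
  then obtain f where f: "\<And>i. i \<in> I \<Longrightarrow> f i \<in> Hom C M M \<and>
      (\<forall>l. is_kernel C (f i) l \<longrightarrow> sub_le C l (k i) \<and> sub_le C (k i) l)"
    unfolding bchoice_iff by blast
  \<comment> \<open>The hypothesis decides which kernels \<open>l i\<close> occur; hence
    \<open>f i\<close> was chosen with control over all of its kernels.\<close>
  then obtain l m d where l: "\<forall>i\<in>I. is_kernel C (f i) (l i)"
    and m: "is_intersection C M (l ` I) m" "P m d"
    using assms(1)[rule_format, of f] by blast
  have "l ` I \<subseteq> Arr C" "k ` I \<subseteq> Arr C"
    using l k by (auto simp: is_kernel_def direct_summand_def is_sub_def is_mono_def)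
  then have "is_intersection C M (k ` I) m"
    using is_intersection_cong[of l I k M m] f l m(1) by blast
  then show ?thesis
    using m(2) by blast
qed

lemma direct_summands_sum:
  assumes "\<forall>f\<in>I \<rightarrow> Hom C M M. \<exists>k s d.
      (\<forall>i\<in>I. is_image C (f i) (k i)) \<and> is_sum C M (k ` I) s \<and> P s d"
    and k: "k \<in> I \<rightarrow> Collect (direct_summand C M)"
  shows "\<exists>s d. is_sum C M (k ` I) s \<and> P s d"
proof -
  have "\<forall>i\<in>I. \<exists>f. f \<in> Hom C M M \<and>
      (\<forall>l. is_image C f l \<longrightarrow> sub_le C l (k i) \<and> sub_le C (k i) l)"
    using direct_summand_image k by blast
  then obtain f where f: "\<And>i. i \<in> I \<Longrightarrow> f i \<in> Hom C M M \<and>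
      (\<forall>l. is_image C (f i) l \<longrightarrow> sub_le C l (k i) \<and> sub_le C (k i) l)"
    unfolding bchoice_iff by blast
  then obtain l s d where l: "\<forall>i\<in>I. is_image C (f i) (l i)"
    and s: "is_sum C M (l ` I) s" "P s d"
    using assms(1)[rule_format, of f] by blast
  have "is_sum C M (k ` I) s"
    using is_sum_cong[of I l k M s] f l s(1) by blast
  then show ?thesis
    using s(2) by blast
qed

end

theorem corollary6p5:
  fixes C :: "('o, 'a) precategory" and U :: "'i set set"
  assumes "abelian_category C"
  shows "(AB3star U C \<longrightarrow>
           (\<forall>M\<in>Obj C. (self_CS_Baer U C M \<longrightarrow> ESSIP U C M) \<and>
                      (strongly_self_CS_Baer U C M \<longrightarrow> strictly_ESSIP U C M))) \<and>
         (AB3 U C \<longrightarrow>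
           (\<forall>M\<in>Obj C. (dual_self_CS_Baer U C M \<longrightarrow> LSSSP U C M) \<and>
                      (dual_strongly_self_CS_Baer U C M \<longrightarrow> strictly_LSSSP U C M)))"
proof -
  interpret abelian_category C by fact
  note baer = self_CS_Baer_def strongly_self_CS_Baer_def
    dual_self_CS_Baer_def dual_strongly_self_CS_Baer_def
  \<comment> \<open>In all four cases unification reads \<open>P\<close> off the goal:
    \<open>direct_summand\<close> together with \<open>essential_in\<close> or
    \<open>lies_above\<close>, and \<open>fully_invariant\<close> in the strong cases.\<close>
  have "ESSIP U C M" if "self_CS_Baer U C M" for M
    using that unfolding baer ESSIP_def
    by (intro ballI direct_summands_intersection) auto
  moreover have "strictly_ESSIP U C M" if "strongly_self_CS_Baer U C M" for M
    using that unfolding baer strictly_ESSIP_def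
    by (intro ballI direct_summands_intersection) auto
  moreover have "LSSSP U C M" if "dual_self_CS_Baer U C M" for M
    using that unfolding baer LSSSP_def
    by (intro ballI direct_summands_sum) auto
  moreover have "strictly_LSSSP U C M" if "dual_strongly_self_CS_Baer U C M" for M
    using that unfolding baer strictly_LSSSP_def
    by (intro ballI direct_summands_sum) auto
  ultimately show ?thesis by blast
qed

end
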